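(* Let $A,B\in\mathbb{R}_+^{n\times n}$ be irreducible matrices which commute in max algebra, i.e. $AB=BA$, and whose associated digraphs each contain at least one cycle (which is automatic when $n\geq 2$). Then there exists a cycle $c_1$ in $\mathcal{C}(A)$ such that all nodes of $c_1$ belong to the union of the node sets of the strongly connected components of $\mathcal{C}(B)$, and there exists a cycle $c_2$ in $\mathcal{C}(B)$ such that all nodes of $c_2$ belong to the union of the node sets of the strongly connected components of $\mathcal{C}(A)$. In particular, $A$ and $B$ have a common eigennode, i.e. $N_c^A\cap N_c^B\neq\emptyset$.
   Context: Max algebra is the semiring $(\mathbb{R}_+,\oplus,\times)$, where $\mathbb{R}_+=[0,\infty)$, $a\oplus b=\max(a,b)$ and $\times$ is ordinary multiplication; matrix products are over this semiring: $(AB)_{ij}=\max_k a_{ik}b_{kj}$. The associated digraph of $A\in\mathbb{R}_+^{n\times n}$ has node set $\{1,\ldots,n\}$ and an edge $(i,j)$ whenever $a_{ij}>0$; $A$ is irreducible if this digraph is strongly connected. Loops count as cycles. Let $\lambda(A)=\max_{1\le k\le n}\max_{i_1,\ldots,i_k}(a_{i_1i_2}\cdots a_{i_ki_1})^{1/k}$ be the maximal cycle geometric mean. When the associated digraph contains at least one cycle, the critical cycles are the cycles attaining this maximum, and the critical digraph $\mathcal{C}(A)=(N_c^A,E_c^A)$ consists of all nodes $N_c^A$ and edges $E_c^A$ of the associated digraph lying on critical cycles. The elements of $N_c^A$ are called eigennodes (critical nodes) of $A$. *)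

theory Defs
  imports "HOL-Analysis.Finite_Cartesian_Product" "Graph_Theory.Digraph_Component"
begin

definition max_mult :: "real ^ 'n ^ 'n \<Rightarrow> real ^ 'n ^ 'n \<Rightarrow> real ^ 'n ^ ('n :: finite)"
    (infixl \<open>\<otimes>\<^sub>m\<close> 70) where
  "A \<otimes>\<^sub>m B = (\<chi> i j. Max (range (\<lambda>k. A $ i $ k * B $ k $ j)))"

definition assoc_digraph :: "real ^ 'n ^ 'n \<Rightarrow> ('n :: finite, 'n \<times> 'n) pre_digraph" where
  "assoc_digraph A =
     \<lparr> verts = UNIV, arcs = {(i, j). A $ i $ j > 0}, tail = fst, head = snd \<rparr>"

(* A 1 x 1 matrix is always irreducible in this sense, even if its entry is 0. *)
definition irreducible_mat :: "real ^ 'n ^ ('n :: finite) \<Rightarrow> bool" where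
  "irreducible_mat A \<longleftrightarrow> strongly_connected (assoc_digraph A)"

definition geometric_mean :: "real ^ 'n ^ 'n \<Rightarrow> ('n \<times> 'n) list \<Rightarrow> real" where
  "geometric_mean A es = root (length es) (prod_list (map (\<lambda>(i, j). A $ i $ j) es))"

(* For a node sequence vs = [i_1, ..., i_k], the list zip vs (rotate1 vs) consists of the pairs
   (i_1, i_2), ..., (i_(k-1), i_k), (i_k, i_1).  As the maximum ranges over all node sequences of
   length at most n, these pairs need not be edges; a sequence using a non-edge has mean 0. *)
definition max_cycle_mean :: "real ^ 'n ^ ('n :: finite) \<Rightarrow> real" where
  "max_cycle_mean A =
     Max {geometric_mean A (zip vs (rotate1 vs)) |vs. 1 \<le> length vs \<and> length vs \<le> CARD('n)}"

(* Cycles are those of the library: lists of arcs forming a nonempty closed walk without repeated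
   nodes (apart from its two ends).  Loops are cycles of length 1. *)
definition critical_cycle :: "real ^ 'n ^ ('n :: finite) \<Rightarrow> ('n \<times> 'n) list \<Rightarrow> bool" where
  "critical_cycle A c \<longleftrightarrow>
     pre_digraph.cycle (assoc_digraph A) c \<and> geometric_mean A c = max_cycle_mean A"

(* Since a cycle is a list of pairs and is closed, its nodes are the tails of its arcs. *)
definition cycle_nodes :: "('n \<times> 'n) list \<Rightarrow> 'n set" where
  "cycle_nodes c = fst ` set c"

definition critical_digraph :: "real ^ 'n ^ 'n \<Rightarrow> ('n :: finite, 'n \<times> 'n) pre_digraph" where
  "critical_digraph A =
     \<lparr> verts = {i. \<exists>c. critical_cycle A c \<and> i \<in> cycle_nodes c},
       arcs = {e. \<exists>c. critical_cycle A c \<and> e \<in> set c},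
       tail = fst, head = snd \<rparr>"

definition eigennodes :: "real ^ 'n ^ ('n :: finite) \<Rightarrow> 'n set" where
  "eigennodes A = verts (critical_digraph A)"

end

theory Submission
  imports Defs
begin

text \<open>
  Divide \<open>A\<close> and \<open>B\<close> by their maximal cycle means, so that both means become 1. The rescaled
  matrices still commute, and the plan is to give them a common eigenvector \<open>x > 0\<close> with eigenvalue 1
  (\<open>ex_common_eigenvector\<close>) and then to look only at the arcs \<open>(i, j)\<close> where the inequality
  \<open>a\<^sub>i\<^sub>j x\<^sub>j \<le> x\<^sub>i\<close> is tight, called saturated below.

  The eigenvector comes in two stages. Once all cycle weights are at most 1, walk weights are bounded,
  and the suprema of the weights of the walks from each node form a vector \<open>u > 0\<close> with
  \<open>A u \<le> u\<close>; taking the supremum of the vectors \<open>B\<^sup>k u\<close> produces a common subeigenvector \<open>v\<close>. The decreasing sequence \<open>A\<^sup>k v\<close> has a limit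
  \<open>w\<close> with \<open>A w = w\<close>, and \<open>B w \<le> w\<close> survives because \<open>A\<close> and \<open>B\<close> commute; the limit of \<open>B\<^sup>k w\<close> is
  then fixed by both matrices. The danger is that a limit vanishes. It does not: along a cycle of
  weight 1 a subeigenvector is tight on every arc, so its values on the nodes of the cycle never
  decrease under iteration, and irreducibility spreads positivity from there to all nodes.

  Let \<open>R\<close> and \<open>S\<close> be the saturated relations of \<open>A\<close> and \<open>B\<close> for \<open>x\<close>. Three facts finish the proof.
  A cycle of saturated arcs is critical, since the factors \<open>x\<^sub>j / x\<^sub>i\<close> cancel around a cycle
  (\<open>critical_cycle_if_saturated\<close>). Every node has a successor in \<open>R\<close> and one in \<open>S\<close>, since \<open>x\<close> is an
  eigenvector and not merely a subeigenvector. Finally \<open>R O S = S O R\<close>, since both sides are the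
  saturated relation of the matrix product (\<open>saturated_max_mult\<close>). What remains is a statement
  about finite relations (\<open>commuting_relations_cycle\<close>): if commuting relations are both serial, then
  \<open>R\<close> has a cycle all of whose nodes lie on cycles of \<open>S\<close>.
\<close>

section \<open>Commuting finite relations\<close>

lemma ex_cycle_if_serial:
  fixes Q :: "('a :: finite) rel"
  assumes "i\<^sub>0 \<in> K" and succ: "\<And>i. i \<in> K \<Longrightarrow> \<exists>j \<in> K. (i, j) \<in> Q"
  shows "\<exists>i. (i, i) \<in> (Q \<inter> K \<times> K)\<^sup>+"
proof (rule ccontr)
  let ?Q = "Q \<inter> K \<times> K"
  assume "\<not> ?thesis"
  then have "acyclic ?Q" by (auto simp: acyclic_def)
  then have "wf (?Q\<inverse>)" by (intro finite_acyclic_wf_converse) auto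
  then obtain z where z: "z \<in> K" "\<And>y. (y, z) \<in> ?Q\<inverse> \<Longrightarrow> y \<notin> K"
    using \<open>i\<^sub>0 \<in> K\<close> by (rule wfE_min) blast
  obtain y where "y \<in> K" "(z, y) \<in> Q" using succ[OF z(1)] by blast
  with z show False by blast
qed

text \<open>
  Any \<open>R\<close>-successor \<open>j\<close> of \<open>i\<close> satisfies \<open>(i, j) \<in> T O R = R O T\<close>, because of the loop at \<open>i\<close>. Hence some
  \<open>R\<close>-successor of \<open>i\<close> is \<open>T\<close>-related to \<open>j\<close>. Following these backwards inside the finite set of
  \<open>R\<close>-successors must close a \<open>T\<close>-cycle, which transitivity shrinks to a loop.
\<close>

lemma commuting_relations_step:
  fixes R T :: "('a :: finite) rel"
  assumes commute: "T O R = R O T" and "trans T" and "(i, i) \<in> T" and "(i, j\<^sub>0) \<in> R"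
  shows "\<exists>j. (i, j) \<in> R \<and> (j, j) \<in> T"
proof -
  let ?J = "R `` {i}"
  have "\<exists>j' \<in> ?J. (j, j') \<in> T\<inverse>" if "j \<in> ?J" for j
  proof -
    from that \<open>(i, i) \<in> T\<close> have "(i, j) \<in> T O R" by auto
    then obtain j' where "(i, j') \<in> R" "(j', j) \<in> T" unfolding commute by auto
    then show ?thesis by auto
  qed
  then obtain j where j: "(j, j) \<in> (T\<inverse> \<inter> ?J \<times> ?J)\<^sup>+"
    using ex_cycle_if_serial[of j\<^sub>0 ?J "T\<inverse>"] \<open>(i, j\<^sub>0) \<in> R\<close> by auto
  then have "j \<in> ?J" by (meson IntD2 SigmaD1 tranclD)
  have "(j, j) \<in> (T\<inverse>)\<^sup>+" by (rule trancl_mono[OF j]) auto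
  then have "(j, j) \<in> T" using \<open>trans T\<close> by (metis converseD trancl_converse trancl_id)
  with \<open>j \<in> ?J\<close> show ?thesis by auto
qed

lemma trancl_relcomp_commute:
  assumes "S O R = R O S"
  shows "S\<^sup>+ O R = R O S\<^sup>+"
proof -
  have 1: "\<exists>w. (x, w) \<in> R \<and> (w, z) \<in> S\<^sup>+" if "(x, y) \<in> S\<^sup>+" "(y, z) \<in> R" for x y z
    using that
  proof (induction arbitrary: z rule: trancl_induct)
    case (base y)
    then have "(x, z) \<in> R O S" using assms by auto
    then show ?case by auto
  next
    case (step y u)
    then have "(y, z) \<in> R O S" using assms by auto
    then obtain w where "(y, w) \<in> R" "(w, z) \<in> S" by auto
    with step.IH show ?case by (meson trancl.trancl_into_trancl)
  qed
  have 2: "\<exists>w. (x, w) \<in> S\<^sup>+ \<and> (w, z) \<in> R" if "(y, z) \<in> S\<^sup>+" "(x, y) \<in> R" for x y z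
    using that
  proof (induction rule: trancl_induct)
    case (base z)
    then have "(x, z) \<in> S O R" using assms by auto
    then show ?case by auto
  next
    case (step u z)
    then obtain w where w: "(x, w) \<in> S\<^sup>+" "(w, u) \<in> R" by auto
    with step have "(w, z) \<in> S O R" using assms by auto
    then obtain w' where "(w, w') \<in> S" "(w', z) \<in> R" by auto
    with w show ?case by (meson trancl.trancl_into_trancl)
  qed
  from 1 2 show ?thesis by (auto simp: relcomp_unfold)
qed

text \<open>
  The set \<open>K\<close> of nodes on cycles of \<open>S\<close> is nonempty, and every node of \<open>K\<close> keeps an
  \<open>R\<close>-successor in \<open>K\<close>, so that \<open>R\<close> restricted to \<open>K\<close> must run into a cycle.
\<close>

lemma commuting_relations_cycle:
  fixes R S :: "('a :: finite) rel"
  assumes "R O S = S O R" and R: "\<And>i. \<exists>j. (i, j) \<in> R" and S: "\<And>i. \<exists>j. (i, j) \<in> S"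
  defines "K \<equiv> {i. (i, i) \<in> S\<^sup>+}"
  shows "\<exists>i. (i, i) \<in> (R \<inter> K \<times> K)\<^sup>+"
proof -
  obtain i\<^sub>0 where "i\<^sub>0 \<in> K"
    using ex_cycle_if_serial[of undefined UNIV S] S unfolding K_def
    by (metis Int_UNIV_right UNIV_I UNIV_Times_UNIV mem_Collect_eq)
  moreover have "\<exists>j \<in> K. (i, j) \<in> R" if "i \<in> K" for i
  proof -
    obtain j where "(i, j) \<in> R" using R by auto
    moreover have "(i, i) \<in> S\<^sup>+" using that unfolding K_def by simp
    ultimately show ?thesis
      using commuting_relations_step[OF trancl_relcomp_commute[OF assms(1)[symmetric]] trans_trancl]
      unfolding K_def by blast
  qed
  ultimately show ?thesis by (rule ex_cycle_if_serial)
qed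

section \<open>Cycles in digraphs whose arcs are pairs\<close>

lemma cas_iff_zip:
  assumes "tail G = fst" "head G = snd"
  shows "pre_digraph.cas G u c v \<longleftrightarrow> u # map snd c = map fst c @ [v]"
  using assms by (induction c arbitrary: u) (auto simp: pre_digraph.cas.simps)

text \<open>
  Turns the library notion of a cycle into equations between lists. The equation between \<open>map snd c\<close>
  and \<open>rotate1 (map fst c)\<close> links it with the cyclic node sequences in the maximal cycle mean, and
  the right-hand side makes it easy to move a cycle from one digraph to another.
\<close>

lemma cycle_iff:
  assumes "tail G = fst" "head G = snd"
  shows "pre_digraph.cycle G c \<longleftrightarrow> c \<noteq> [] \<and> set c \<subseteq> arcs G \<and> fst (hd c) \<in> verts G \<and>
           map snd c = rotate1 (map fst c) \<and> distinct (map fst c)"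
proof (cases "c = []")
  case True
  then show ?thesis by (simp add: pre_digraph.cycle_def)
next
  case False
  \<comment> \<open>The base point of a closed walk is forced to be the tail of its first arc.\<close>
  have walk: "pre_digraph.awalk G u c u \<longleftrightarrow> u = fst (hd c) \<and> u \<in> verts G \<and> set c \<subseteq> arcs G \<and>
      map snd c = rotate1 (map fst c)" for u
    using False by (cases c) (auto simp: pre_digraph.awalk_def cas_iff_zip[OF assms])
  have "tl (pre_digraph.awalk_verts G u c) = map snd c" if "pre_digraph.awalk G u c u" for u
    using that False assms(2) pre_digraph.awalk_verts_conv'[of G u c u]
    by (simp add: pre_digraph.awalk_def)
  moreover have "distinct (map snd c) \<longleftrightarrow> distinct (map fst c)" if "map snd c = rotate1 (map fst c)"
    unfolding that by simp
  ultimately show ?thesis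
    using False unfolding pre_digraph.cycle_def by (metis walk)
qed

abbreviation rel_digraph :: "'a rel \<Rightarrow> ('a, 'a \<times> 'a) pre_digraph" where
  "rel_digraph R \<equiv> \<lparr>verts = UNIV, arcs = R, tail = fst, head = snd\<rparr>"

text \<open>
  A first step \<open>(i, j)\<close>, followed by a walk from \<open>j\<close> back to \<open>i\<close> from which all repeated nodes have been
  removed, is a cycle.
\<close>

lemma cycle_through_if_trancl:
  fixes R :: "'a rel"
  assumes "(i, i) \<in> R\<^sup>+"
  shows "\<exists>c. pre_digraph.cycle (rel_digraph R) c \<and> i \<in> cycle_nodes c"
proof -
  let ?G = "rel_digraph R"
  interpret wf_digraph ?G by unfold_locales auto
  obtain j where ij: "(i, j) \<in> R" and ji: "(j, i) \<in> R\<^sup>*"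
    using assms by (auto dest: tranclD)
  from ji have "j \<rightarrow>\<^sup>*\<^bsub>?G\<^esub> i"
  proof (induction rule: rtrancl_induct)
    case (step y z)
    have "y \<rightarrow>\<^bsub>?G\<^esub> z" using step.hyps by (auto simp: arcs_ends_conv)
    with step.IH show ?case by (rule reachable_adj_trans)
  qed simp
  then obtain p where p: "apath j p i"
    using reachable_awalk apath_awalk_to_apath by blast
  have "cycle ((i, j) # p)"
    unfolding cycle_def using p ij
    by (auto intro!: exI[of _ i] simp: apath_def awalk_Cons_iff)
  then show ?thesis by (force simp: cycle_nodes_def)
qed

lemma Union_verts_sccs:
  assumes "wf_digraph G"
  shows "(\<Union>H \<in> pre_digraph.sccs G. verts H) = verts G"
proof -
  interpret wf_digraph G by fact
  have "scc_of u \<in> sccs_verts" if "u \<in> verts G" for u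
    unfolding in_sccs_verts_conv_reachable using that in_scc_of_self[OF that]
    by (auto simp: scc_of_def intro: reachable_trans)
  moreover have "S \<subseteq> verts G" if "S \<in> sccs_verts" for S
    using that reachable_in_verts(1) unfolding in_sccs_verts_conv_reachable by blast
  ultimately have "\<Union> sccs_verts = verts G" using in_scc_of_self by blast
  then show ?thesis by (simp add: sccs_verts_conv)
qed

section \<open>Max-algebraic matrices acting on vectors\<close>

definition max_mult_vec :: "real ^ 'n ^ 'n \<Rightarrow> ('n \<Rightarrow> real) \<Rightarrow> ('n :: finite) \<Rightarrow> real"
    (infixr \<open>\<odot>\<close> 75) where
  "A \<odot> x = (\<lambda>i. Max (range (\<lambda>j. A $ i $ j * x j)))"

definition nonneg_mat :: "real ^ 'n ^ ('n :: finite) \<Rightarrow> bool" where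
  "nonneg_mat A \<longleftrightarrow> (\<forall>i j. 0 \<le> A $ i $ j)"

lemma max_mult_vec_ge: "A $ i $ j * x j \<le> (A \<odot> x) i"
  unfolding max_mult_vec_def by (rule Max_ge) auto

lemma max_mult_vec_le_iff: "A \<odot> x \<le> y \<longleftrightarrow> (\<forall>i j. A $ i $ j * x j \<le> y i)"
  by (auto simp: le_fun_def max_mult_vec_def)

lemma max_mult_vec_attained: obtains j where "(A \<odot> x) i = A $ i $ j * x j"
proof -
  have "(A \<odot> x) i \<in> range (\<lambda>j. A $ i $ j * x j)"
    unfolding max_mult_vec_def by (rule Max_in) auto
  then show thesis using that by auto
qed

lemma max_mult_ge: "A $ i $ k * B $ k $ j \<le> (A \<otimes>\<^sub>m B) $ i $ j"
  unfolding max_mult_def by (simp add: Max_ge)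

lemma max_mult_attained: obtains k where "(A \<otimes>\<^sub>m B) $ i $ j = A $ i $ k * B $ k $ j"
proof -
  have "(A \<otimes>\<^sub>m B) $ i $ j \<in> range (\<lambda>k. A $ i $ k * B $ k $ j)"
    unfolding max_mult_def vec_lambda_beta by (rule Max_in) auto
  then show thesis using that by auto
qed

lemma max_mult_vec_mono:
  assumes "nonneg_mat A" "x \<le> y"
  shows "A \<odot> x \<le> A \<odot> y"
  unfolding max_mult_vec_le_iff
proof (intro allI)
  fix i j
  have "A $ i $ j * x j \<le> A $ i $ j * y j"
    using assms by (auto simp: nonneg_mat_def le_fun_def intro: mult_left_mono)
  also have "\<dots> \<le> (A \<odot> y) i" by (rule max_mult_vec_ge)
  finally show "A $ i $ j * x j \<le> (A \<odot> y) i" .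
qed

lemma max_mult_vec_nonneg:
  fixes A :: "real ^ 'n ^ ('n :: finite)"
  assumes "nonneg_mat A" "(\<lambda>_. 0) \<le> x"
  shows "(\<lambda>_. 0) \<le> A \<odot> x"
proof (rule le_funI)
  fix i :: 'n
  have "0 \<le> A $ i $ i * x i" using assms by (simp add: nonneg_mat_def le_fun_def)
  also have "\<dots> \<le> (A \<odot> x) i" by (rule max_mult_vec_ge)
  finally show "0 \<le> (A \<odot> x) i" .
qed

lemma max_mult_vec_assoc:
  assumes A: "nonneg_mat A" and x: "(\<lambda>_. 0) \<le> x"
  shows "(A \<otimes>\<^sub>m B) \<odot> x = A \<odot> B \<odot> x"
proof (rule ext, rule antisym)
  fix i
  obtain j where j: "((A \<otimes>\<^sub>m B) \<odot> x) i = (A \<otimes>\<^sub>m B) $ i $ j * x j"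
    by (rule max_mult_vec_attained)
  obtain k where k: "(A \<otimes>\<^sub>m B) $ i $ j = A $ i $ k * B $ k $ j"
    by (rule max_mult_attained)
  have "A $ i $ k * (B $ k $ j * x j) \<le> A $ i $ k * (B \<odot> x) k"
    using A by (intro mult_left_mono max_mult_vec_ge) (auto simp: nonneg_mat_def)
  also have "\<dots> \<le> (A \<odot> B \<odot> x) i" by (rule max_mult_vec_ge)
  finally show "((A \<otimes>\<^sub>m B) \<odot> x) i \<le> (A \<odot> B \<odot> x) i" by (simp add: j k mult_ac)
next
  fix i
  obtain k where k: "(A \<odot> B \<odot> x) i = A $ i $ k * (B \<odot> x) k"
    by (rule max_mult_vec_attained)
  obtain j where j: "(B \<odot> x) k = B $ k $ j * x j"
    by (rule max_mult_vec_attained)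
  have "A $ i $ k * B $ k $ j * x j \<le> (A \<otimes>\<^sub>m B) $ i $ j * x j"
    using x by (intro mult_right_mono max_mult_ge) (auto simp: le_fun_def)
  also have "\<dots> \<le> ((A \<otimes>\<^sub>m B) \<odot> x) i" by (rule max_mult_vec_ge)
  finally show "(A \<odot> B \<odot> x) i \<le> ((A \<otimes>\<^sub>m B) \<odot> x) i" by (simp add: j k mult_ac)
qed

lemma max_mult_vec_commute:
  assumes "nonneg_mat A" "nonneg_mat B" "A \<otimes>\<^sub>m B = B \<otimes>\<^sub>m A" "(\<lambda>_. 0) \<le> x"
  shows "A \<odot> B \<odot> x = B \<odot> A \<odot> x"
  using assms max_mult_vec_assoc by metis

lemma funpow_max_mult_vec_nonneg:
  assumes "nonneg_mat A" "(\<lambda>_. 0) \<le> x"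
  shows "(\<lambda>_. 0) \<le> (((\<odot>) A) ^^ k) x"
  using assms by (induction k) (auto simp: max_mult_vec_nonneg)

lemma funpow_max_mult_vec_commute:
  assumes "nonneg_mat A" "nonneg_mat B" "A \<otimes>\<^sub>m B = B \<otimes>\<^sub>m A" "(\<lambda>_. 0) \<le> x"
  shows "A \<odot> (((\<odot>) B) ^^ k) x = (((\<odot>) B) ^^ k) (A \<odot> x)"
proof (induction k)
  case (Suc k)
  have "A \<odot> B \<odot> (((\<odot>) B) ^^ k) x = B \<odot> A \<odot> (((\<odot>) B) ^^ k) x"
    using assms by (intro max_mult_vec_commute funpow_max_mult_vec_nonneg)
  with Suc show ?case by simp
qed simp

lemma funpow_max_mult_vec_mono:
  assumes "nonneg_mat A" "x \<le> y"
  shows "(((\<odot>) A) ^^ k) x \<le> (((\<odot>) A) ^^ k) y"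
  using assms by (induction k) (auto simp: max_mult_vec_mono)

lemma max_mult_scaleR:
  assumes "0 \<le> a" "0 \<le> b"
  shows "(a *\<^sub>R A) \<otimes>\<^sub>m (b *\<^sub>R B) = (a * b) *\<^sub>R (A \<otimes>\<^sub>m B)"
proof -
  have mono: "mono (\<lambda>t. a * b * t)"
    using assms by (intro monoI mult_left_mono) auto
  have "a * b * Max (range (\<lambda>k. A $ i $ k * B $ k $ j))
      = Max (range (\<lambda>k. (a *\<^sub>R A) $ i $ k * (b *\<^sub>R B) $ k $ j))" for i j
    by (subst mono_Max_commute[OF mono]) (auto simp: image_image mult_ac)
  then show ?thesis by (simp add: max_mult_def vec_eq_iff)
qed

text \<open>
  Continuity holds because each coordinate is a maximum of finitely many continuous functions.
\<close>

lemma tendsto_max_mult_vec: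
  assumes "\<And>j. (\<lambda>k. x k j) \<longlonglongrightarrow> w j"
  shows "(\<lambda>k. (A \<odot> x k) i) \<longlonglongrightarrow> (A \<odot> w) i"
proof -
  have "(\<lambda>k. Max ((\<lambda>j. A $ i $ j * x k j) ` J)) \<longlonglongrightarrow> Max ((\<lambda>j. A $ i $ j * w j) ` J)"
    if "finite J" "J \<noteq> {}" for J
    using that by (induction rule: finite_ne_induct) (auto intro!: tendsto_max tendsto_mult_left assms)
  then show ?thesis by (simp add: max_mult_vec_def)
qed

lemma max_mult_vec_scale:
  assumes "0 \<le> c"
  shows "A \<odot> (\<lambda>i. c * x i) = (\<lambda>i. c * (A \<odot> x) i)"
proof -
  have mono: "mono (\<lambda>t. c * t)"
    using assms by (intro monoI mult_left_mono) auto
  show ?thesis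
    unfolding max_mult_vec_def
    by (subst mono_Max_commute[OF mono]) (auto simp: image_image mult_ac)
qed

section \<open>Walk weights and common subeigenvectors\<close>

definition arc_prod :: "real ^ 'n ^ ('n :: finite) \<Rightarrow> ('n \<times> 'n) list \<Rightarrow> real" where
  "arc_prod A es = prod_list (map (\<lambda>(i, j). A $ i $ j) es)"

definition walk_weight :: "real ^ 'n ^ ('n :: finite) \<Rightarrow> 'n list \<Rightarrow> real" where
  "walk_weight A vs = arc_prod A (zip vs (tl vs))"

text \<open>
  For nonnegative \<open>A\<close> this says that the maximal cycle geometric mean is 1, without taking roots.
\<close>

definition unit_cycle_mean :: "real ^ 'n ^ ('n :: finite) \<Rightarrow> bool" where
  "unit_cycle_mean A \<longleftrightarrow>
     (\<forall>vs. vs \<noteq> [] \<and> length vs \<le> CARD('n) \<longrightarrow> arc_prod A (zip vs (rotate1 vs)) \<le> 1) \<and>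
     (\<exists>vs. vs \<noteq> [] \<and> arc_prod A (zip vs (rotate1 vs)) = 1)"

lemma arc_prod_nonneg: "nonneg_mat A \<Longrightarrow> 0 \<le> arc_prod A es"
  unfolding arc_prod_def by (rule prod_list_nonneg) (auto simp: nonneg_mat_def)

lemma walk_weight_simps [simp]:
  "walk_weight A [] = 1"
  "walk_weight A [i] = 1"
  "walk_weight A (i # j # vs) = A $ i $ j * walk_weight A (j # vs)"
  by (simp_all add: walk_weight_def arc_prod_def)

lemma walk_weight_nonneg: "nonneg_mat A \<Longrightarrow> 0 \<le> walk_weight A vs"
  unfolding walk_weight_def by (rule arc_prod_nonneg)

lemma walk_weight_append:
  "walk_weight A (us @ i # vs) = walk_weight A (us @ [i]) * walk_weight A (i # vs)"
proof (induction us)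
  case (Cons u us)
  then show ?case by (cases us) auto
qed simp

lemma walk_weight_closed:
  "walk_weight A (i # vs @ [i]) = arc_prod A (zip (i # vs) (rotate1 (i # vs)))"
proof -
  have "zip ((i # vs) @ [i]) (vs @ [i]) = zip (i # vs) (vs @ [i])"
    by (subst zip_append1) simp
  then show ?thesis by (simp add: walk_weight_def)
qed

text \<open>
  Among the first \<open>n + 1\<close> nodes of a long walk one is repeated. Cutting out the closed walk in
  between, which has at most \<open>n\<close> arcs and weight at most 1, does not decrease the weight. So the
  weights of all walks are bounded by those of the finitely many walks with at most \<open>n\<close> nodes.
\<close>

lemma walk_weight_bounded:
  fixes A :: "real ^ 'n ^ ('n :: finite)"
  assumes A: "nonneg_mat A" and "unit_cycle_mean A"
  shows "\<exists>C. \<forall>vs. walk_weight A vs \<le> C"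
proof -
  let ?n = "CARD('n)"
  let ?V = "{vs :: 'n list. length vs \<le> ?n}"
  let ?C = "Max (walk_weight A ` ?V)"
  have fin: "finite ?V"
    using finite_lists_length_le[of "UNIV :: 'n set" ?n] by simp
  have "walk_weight A vs \<le> ?C" for vs
  proof (induction "length vs" arbitrary: vs rule: less_induct)
    case less
    show ?case
    proof (cases "length vs \<le> ?n")
      case True
      with fin show ?thesis by (intro Max_ge) auto
    next
      case False
      have "\<not> distinct (take (Suc ?n) vs)"
      proof
        assume "distinct (take (Suc ?n) vs)"
        then have "card (set (take (Suc ?n) vs)) = Suc ?n"
          using False by (simp add: distinct_card)
        moreover have "card (set (take (Suc ?n) vs)) \<le> ?n" by (rule card_mono) auto
        ultimately show False by simp
      qed
      then obtain xs ys zs i where take: "take (Suc ?n) vs = xs @ [i] @ ys @ [i] @ zs"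
        using not_distinct_decomp by blast
      obtain zs' where vs: "vs = xs @ i # ys @ i # zs'"
        using append_take_drop_id[of "Suc ?n" vs] unfolding take
        by (metis append.assoc append_Cons append_Nil)
      have "length (take (Suc ?n) vs) = Suc ?n" using False by simp
      then have "length (i # ys) \<le> ?n" unfolding take by simp
      then have cyc: "walk_weight A (i # ys @ [i]) \<le> 1"
        using assms(2) unfolding walk_weight_closed unit_cycle_mean_def by blast
      have "walk_weight A vs =
          walk_weight A (i # ys @ [i]) * (walk_weight A (xs @ [i]) * walk_weight A (i # zs'))"
        unfolding vs
        using walk_weight_append[of A xs i "ys @ i # zs'"] walk_weight_append[of A "i # ys" i zs']
        by simp
      also have "\<dots> \<le> walk_weight A (xs @ [i]) * walk_weight A (i # zs')"
        using cyc by (intro mult_left_le_one_le mult_nonneg_nonneg walk_weight_nonneg A)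
      also have "\<dots> = walk_weight A (xs @ i # zs')" by (rule walk_weight_append[symmetric])
      also have "\<dots> \<le> ?C" by (rule less) (simp add: vs)
      finally show ?thesis .
    qed
  qed
  then show ?thesis by blast
qed

text \<open>
  Let \<open>u i\<close> be the supremum of the weights of the walks that start in \<open>i\<close>. The one-node walk gives
  \<open>u i \<ge> 1\<close>, and prolonging walks by an arc in front gives the subeigenvector inequality.
\<close>

lemma ex_subeigenvector:
  fixes A :: "real ^ 'n ^ ('n :: finite)"
  assumes A: "nonneg_mat A" and "unit_cycle_mean A"
  shows "\<exists>u. (\<lambda>_. 1) \<le> u \<and> A \<odot> u \<le> u"
proof -
  obtain C where C: "\<And>vs. walk_weight A vs \<le> C"
    using walk_weight_bounded[OF assms] by blast
  define u where "u i = (SUP vs. walk_weight A (i # vs))" for i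
  have ge: "walk_weight A (i # vs) \<le> u i" for i vs
    unfolding u_def using C by (intro cSUP_upper bdd_aboveI2[where M = C]) auto
  have one: "1 \<le> u i" for i using ge[of i "[]"] by simp
  have "A $ i $ j * u j \<le> u i" for i j
  proof (cases "A $ i $ j = 0")
    case True
    with one[of i] show ?thesis by simp
  next
    case False
    then have pos: "A $ i $ j > 0" using A by (metis nonneg_mat_def order_le_less)
    have "u j \<le> u i / A $ i $ j"
      unfolding u_def[of j]
    proof (rule cSUP_least)
      fix vs
      have "A $ i $ j * walk_weight A (j # vs) \<le> u i" using ge[of i "j # vs"] by simp
      with pos show "walk_weight A (j # vs) \<le> u i / A $ i $ j" by (simp add: field_simps)
    qed simp
    with pos show ?thesis by (simp add: field_simps)
  qed
  then have "A \<odot> u \<le> u" by (simp add: max_mult_vec_le_iff)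
  with one show ?thesis by (auto simp: le_fun_def)
qed

text \<open>
  Start from a subeigenvector \<open>u\<close> of \<open>A\<close> and take the supremum \<open>v\<close> of the vectors \<open>B\<^sup>k u\<close>. Each of them is a
  subeigenvector of \<open>A\<close> by commutativity, and \<open>B\<close> only shifts the sequence. The supremum is finite
  because a multiple of a subeigenvector of \<open>B\<close> dominates the sequence.
\<close>

lemma ex_common_subeigenvector:
  fixes A B :: "real ^ 'n ^ ('n :: finite)"
  assumes A: "nonneg_mat A" "unit_cycle_mean A" and B: "nonneg_mat B" "unit_cycle_mean B"
    and commute: "A \<otimes>\<^sub>m B = B \<otimes>\<^sub>m A"
  shows "\<exists>v. (\<forall>i. 0 < v i) \<and> A \<odot> v \<le> v \<and> B \<odot> v \<le> v"
proof -
  obtain u where u: "(\<lambda>_. 1) \<le> u" "A \<odot> u \<le> u" using ex_subeigenvector[OF A] by blast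
  obtain w where w: "(\<lambda>_. 1) \<le> w" "B \<odot> w \<le> w" using ex_subeigenvector[OF B] by blast
  define c where "c = Max (range u)"
  have uc: "u i \<le> c" for i unfolding c_def by (rule Max_ge) auto
  have u1: "1 \<le> u i" for i using u(1) by (simp add: le_fun_def)
  with uc have c: "0 \<le> c" by (meson order_trans zero_le_one)
  have u0: "(\<lambda>_. 0) \<le> u" using u1 by (simp add: le_fun_def order_trans[OF zero_le_one])
  let ?x = "\<lambda>k. (((\<odot>) B) ^^ k) u"
  \<comment> \<open>The factor \<open>c\<close> is chosen with \<open>u \<le> c w\<close>, which \<open>B\<close> then preserves.\<close>
  have bound: "?x k \<le> (\<lambda>i. c * w i)" for k
  proof (induction k)
    case 0
    have "u i \<le> c * w i" for i
      using mult_mono[OF uc[of i], of 1 "w i"] c w(1) by (auto simp: le_fun_def)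
    then show ?case by (simp add: le_fun_def)
  next
    case (Suc k)
    have "B \<odot> ?x k \<le> B \<odot> (\<lambda>i. c * w i)" by (rule max_mult_vec_mono[OF B(1) Suc])
    also have "\<dots> = (\<lambda>i. c * (B \<odot> w) i)" by (rule max_mult_vec_scale[OF c])
    also have "\<dots> \<le> (\<lambda>i. c * w i)" using w(2) c by (auto simp: le_fun_def intro: mult_left_mono)
    finally show ?case by simp
  qed
  define v where "v i = (SUP k. ?x k i)" for i
  have ge: "?x k i \<le> v i" for k i
    unfolding v_def using bound
    by (intro cSUP_upper bdd_aboveI2[where M = "c * w i"]) (auto simp: le_fun_def)
  have pos: "0 < v i" for i using ge[of 0 i] u1[of i] by simp
  have sub: "D \<odot> v \<le> v" if D: "nonneg_mat D" and step: "\<And>k i. \<exists>l. (D \<odot> ?x k) i \<le> ?x l i" for D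
    unfolding max_mult_vec_le_iff
  proof (intro allI)
    fix i j
    have le: "D $ i $ j * ?x k j \<le> v i" for k
      using step[of k i] ge max_mult_vec_ge[of D i j "?x k"] by (meson order_trans)
    show "D $ i $ j * v j \<le> v i"
    proof (cases "D $ i $ j = 0")
      case True
      with pos[of i] show ?thesis by simp
    next
      case False
      then have "D $ i $ j > 0" using D by (metis nonneg_mat_def order_le_less)
      moreover from this have "v j \<le> v i / D $ i $ j"
        unfolding v_def[of j] using le by (intro cSUP_least) (auto simp: field_simps)
      ultimately show ?thesis by (simp add: field_simps)
    qed
  qed
  have "A \<odot> ?x k \<le> ?x k" for k
    using funpow_max_mult_vec_commute[OF A(1) B(1) commute u0, of k]
      funpow_max_mult_vec_mono[OF B(1) u(2), of k] by simp
  then have "A \<odot> v \<le> v" using sub[OF A(1)] by (meson le_funD)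
  moreover have "B \<odot> v \<le> v"
  proof (rule sub[OF B(1)])
    fix k i
    have "(B \<odot> ?x k) i \<le> ?x (Suc k) i" by simp
    then show "\<exists>l. (B \<odot> ?x k) i \<le> ?x l i" by blast
  qed
  ultimately show ?thesis using pos by blast
qed

section \<open>Cycles of weight 1 and common eigenvectors\<close>

text \<open>
  The closed-walk version below follows with \<open>vs = rotate1 us\<close>. Induction needs two unrelated lists, and
  then the factors \<open>x\<close> no longer cancel, so that their products stay on both sides.
\<close>

lemma arc_prod_rescale:
  assumes "length us = length vs" "\<And>i. i \<in> set us \<union> set vs \<Longrightarrow> x i \<noteq> 0"
  shows "prod_list (map (\<lambda>(i, j). A $ i $ j * x j / x i) (zip us vs)) * prod_list (map x us)
         = arc_prod A (zip us vs) * prod_list (map x vs)"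
  using assms
proof (induction us vs rule: list_induct2)
  case (Cons i us j vs)
  let ?p = "prod_list (map (\<lambda>(i, j). A $ i $ j * x j / x i) (zip us vs))"
  have IH: "?p * prod_list (map x us) = arc_prod A (zip us vs) * prod_list (map x vs)"
    using Cons by auto
  have "x i \<noteq> 0" using Cons.prems by auto
  then have "A $ i $ j * x j / x i * ?p * (x i * prod_list (map x us))
      = A $ i $ j * x j * (?p * prod_list (map x us))" by simp
  also have "\<dots> = A $ i $ j * arc_prod A (zip us vs) * (x j * prod_list (map x vs))"
    unfolding IH by simp
  finally show ?case by (simp add: arc_prod_def)
qed (simp add: arc_prod_def)

lemma prod_list_map_rotate1:
  fixes x :: "'a \<Rightarrow> 'b :: comm_monoid_mult"
  shows "prod_list (map x (rotate1 vs)) = prod_list (map x vs)"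
  by (cases vs) (simp_all add: mult.commute)

text \<open>
  The diagonal similarity \<open>a\<^sub>i\<^sub>j x\<^sub>j / x\<^sub>i\<close> preserves the weights of closed walks, as the factors cancel.
\<close>

lemma arc_prod_closed_rescale:
  assumes "\<And>i. i \<in> set vs \<Longrightarrow> x i \<noteq> 0"
  shows "arc_prod A (zip vs (rotate1 vs))
         = prod_list (map (\<lambda>(i, j). A $ i $ j * x j / x i) (zip vs (rotate1 vs)))"
proof -
  have "prod_list (map x vs) \<noteq> 0" using assms by (auto simp: prod_list_zero_iff)
  with arc_prod_rescale[of vs "rotate1 vs" x A] assms show ?thesis
    by (simp add: prod_list_map_rotate1)
qed

lemma prod_list_eq_1D:
  fixes ts :: "real list"
  assumes "prod_list ts = 1" "\<And>t. t \<in> set ts \<Longrightarrow> 0 \<le> t \<and> t \<le> 1"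
  shows "\<forall>t \<in> set ts. t = 1"
  using assms
proof (induction ts)
  case (Cons t ts)
  have le: "prod_list us \<le> 1" if "\<And>t. t \<in> set us \<Longrightarrow> 0 \<le> t \<and> t \<le> (1 :: real)" for us
    using that by (induction us) (auto intro!: mult_le_one prod_list_nonneg)
  have 0: "0 \<le> prod_list ts" "prod_list ts \<le> 1"
    using Cons.prems by (auto intro!: prod_list_nonneg le)
  have t: "0 \<le> t" "t \<le> 1" "t * prod_list ts = 1" using Cons.prems by auto
  have "t * prod_list ts \<le> t" by (rule mult_left_le[OF 0(2) t(1)])
  moreover have "t * prod_list ts \<le> prod_list ts" by (rule mult_left_le_one_le[OF 0(1) t(1,2)])
  ultimately have "t = 1" "prod_list ts = 1" using t 0 by linarith+
  with Cons show ?case by auto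
qed simp

text \<open>
  After rescaling by the subeigenvector \<open>x\<close>, every arc has weight at most 1. Around a closed walk the
  product of these weights is 1, so each of them is 1.
\<close>

lemma unit_cycle_saturated:
  assumes A: "nonneg_mat A" and sub: "A \<odot> x \<le> x"
    and pos: "\<And>i. i \<in> set vs \<Longrightarrow> 0 < x i"
    and cyc: "arc_prod A (zip vs (rotate1 vs)) = 1" and i: "i \<in> set vs"
  shows "(A \<odot> x) i = x i"
proof -
  let ?f = "\<lambda>(i, j). A $ i $ j * x j / x i" and ?es = "zip vs (rotate1 vs)"
  obtain j where ij: "(i, j) \<in> set ?es"
    using i by (metis in_set_impl_in_set_zip1 length_rotate1)
  have "prod_list (map ?f ?es) = 1"
    using arc_prod_closed_rescale[of vs x A] pos cyc by (metis less_irrefl)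
  moreover have "0 \<le> t \<and> t \<le> 1" if "t \<in> set (map ?f ?es)" for t
  proof -
    from that have "t \<in> ?f ` set ?es" by (simp only: set_map)
    then obtain k l where kl: "(k, l) \<in> set ?es" and t: "t = A $ k $ l * x l / x k" by auto
    have "k \<in> set vs" "l \<in> set vs" using kl by (auto dest: set_zip_leftD set_zip_rightD)
    then have "0 < x k" "0 < x l" using pos by auto
    moreover have "A $ k $ l * x l \<le> x k" using sub by (auto simp: max_mult_vec_le_iff)
    ultimately show ?thesis using A by (auto simp: t nonneg_mat_def)
  qed
  ultimately have "\<forall>t \<in> set (map ?f ?es). t = 1" by (rule prod_list_eq_1D)
  moreover have "?f (i, j) \<in> set (map ?f ?es)" unfolding set_map using ij by (rule imageI)
  ultimately have "?f (i, j) = 1" by (rule bspec)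
  then have "A $ i $ j * x j / x i = 1" by (simp only: prod.case)
  then have "x i = A $ i $ j * x j" using pos[OF i] by (metis less_irrefl right_inverse_eq)
  also have "\<dots> \<le> (A \<odot> x) i" by (rule max_mult_vec_ge)
  finally show ?thesis using sub by (simp add: le_fun_def antisym)
qed

text \<open>
  The vector \<open>w\<close> is the limit of the decreasing sequence \<open>A\<^sup>k v\<close>. The last clause is what prevents \<open>w\<close>
  from vanishing. The two clauses on \<open>B\<close> allow the construction to be applied first to \<open>A\<close> and then to
  \<open>B\<close>: the first time \<open>B\<close> has to keep its subeigenvector inequality, the second time the matrix in
  its role, which is then \<open>A\<close>, has to keep its eigenvector equation.
\<close>

lemma ex_eigenvector_below:
  fixes A B :: "real ^ 'n ^ ('n :: finite)"
  assumes A: "nonneg_mat A" and B: "nonneg_mat B" and commute: "A \<otimes>\<^sub>m B = B \<otimes>\<^sub>m A"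
    and v: "(\<lambda>_. 0) \<le> v" "A \<odot> v \<le> v"
  shows "\<exists>w. (\<lambda>_. 0) \<le> w \<and> A \<odot> w = w \<and>
    (B \<odot> v \<le> v \<longrightarrow> B \<odot> w \<le> w) \<and> (B \<odot> v = v \<longrightarrow> B \<odot> w = w) \<and>
    (\<forall>vs. arc_prod A (zip vs (rotate1 vs)) = 1 \<longrightarrow> (\<forall>i \<in> set vs. 0 < v i) \<longrightarrow>
       (\<forall>i \<in> set vs. w i = v i))"
proof -
  let ?x = "\<lambda>k. (((\<odot>) A) ^^ k) v"
  have nonneg: "(\<lambda>_. 0) \<le> ?x k" for k by (rule funpow_max_mult_vec_nonneg[OF A v(1)])
  have step: "A \<odot> ?x k \<le> ?x k" for k
    using funpow_max_mult_vec_mono[OF A v(2), of k] by (simp add: funpow_swap1)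
  have "convergent (\<lambda>k. ?x k i)" for i
  proof (rule Bseq_monoseq_convergent)
    have dec: "decseq (\<lambda>k. ?x k i)"
      using step by (intro decseq_SucI) (simp add: le_fun_def)
    then show "monoseq (\<lambda>k. ?x k i)" by (simp add: monoseq_iff)
    show "Bseq (\<lambda>k. ?x k i)"
      using nonneg by (intro decseq_bounded[OF dec, where B = 0]) (simp add: le_fun_def)
  qed
  then obtain w where w: "\<And>i. (\<lambda>k. ?x k i) \<longlonglongrightarrow> w i"
    unfolding convergent_def by metis
  have lim: "(\<lambda>k. (D \<odot> ?x k) i) \<longlonglongrightarrow> (D \<odot> w) i" for D :: "real ^ 'n ^ 'n" and i
    by (rule tendsto_max_mult_vec[OF w])
  have BA: "B \<odot> ?x k = (((\<odot>) A) ^^ k) (B \<odot> v)" for k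
    using funpow_max_mult_vec_commute[OF B A] commute v(1) by simp
  have "0 \<le> w i" for i
    using nonneg by (intro LIMSEQ_le_const[OF w]) (auto simp: le_fun_def)
  moreover have "(A \<odot> w) i = w i" for i
    using LIMSEQ_unique[OF lim[of A i]] LIMSEQ_Suc[OF w[of i]] by simp
  moreover have "(B \<odot> w) i \<le> w i" if "B \<odot> v \<le> v" for i
  proof (rule LIMSEQ_le[OF lim w])
    have "B \<odot> ?x k \<le> ?x k" for k
      unfolding BA by (rule funpow_max_mult_vec_mono[OF A that])
    then show "\<exists>N. \<forall>k\<ge>N. (B \<odot> ?x k) i \<le> ?x k i" by (auto simp: le_fun_def)
  qed
  moreover have "(B \<odot> w) i = w i" if "B \<odot> v = v" for i
    using LIMSEQ_unique[OF lim[of B i]] w[of i] by (simp add: BA that)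
  moreover have "w i = v i"
    if vs: "arc_prod A (zip vs (rotate1 vs)) = 1" "\<forall>i \<in> set vs. 0 < v i" "i \<in> set vs" for vs i
  proof -
    \<comment> \<open>The iterates are subeigenvectors too, so the weight-1 cycle makes each of them tight on its nodes.\<close>
    have "\<forall>i \<in> set vs. ?x k i = v i" for k
    proof (induction k)
      case (Suc k)
      then show ?case
        using unit_cycle_saturated[OF A step[of k], of vs] vs by simp
    qed simp
    with vs(3) have "(\<lambda>k. ?x k i) = (\<lambda>_. v i)" by auto
    then show ?thesis using w[of i] by (simp add: LIMSEQ_const_iff)
  qed
  ultimately show ?thesis by (intro exI[of _ w]) (auto simp: le_fun_def)
qed

text \<open>
  The inequality \<open>A\<^sub>k\<^sub>l w\<^sub>l \<le> w\<^sub>k\<close> carries positivity backwards along arcs.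
\<close>

lemma eigenvector_pos:
  assumes A: "nonneg_mat A" "irreducible_mat A"
    and w: "(\<lambda>_. 0) \<le> w" "A \<odot> w \<le> w" "0 < w i"
  shows "0 < w j"
proof -
  have "arcs_ends (assoc_digraph A) = {(k, l). A $ k $ l > 0}"
    by (auto simp: arcs_ends_def arc_to_ends_def assoc_digraph_def)
  moreover have "j \<rightarrow>\<^sup>*\<^bsub>assoc_digraph A\<^esub> i"
    using A(2) by (auto simp: irreducible_mat_def strongly_connected_def assoc_digraph_def)
  ultimately have "(j, i) \<in> {(k, l). A $ k $ l > 0}\<^sup>*"
    using reachable_rtranclI by metis
  then show ?thesis
  proof (induction rule: converse_rtrancl_induct)
    case base
    show ?case by (rule w(3))
  next
    case (step k l)
    then have "0 < A $ k $ l * w l" by simp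
    also have "\<dots> \<le> w k" using w(2) by (auto simp: max_mult_vec_le_iff)
    finally show ?case .
  qed
qed

text \<open>
  Two limits: a cycle of weight 1 of \<open>A\<close> keeps the first one from vanishing, and irreducibility of \<open>A\<close>
  then makes it positive everywhere. So it is positive on a cycle of weight 1 of \<open>B\<close>, where the second
  limit keeps its values, and irreducibility of \<open>B\<close> does the rest.
\<close>

lemma ex_common_eigenvector:
  fixes A B :: "real ^ 'n ^ ('n :: finite)"
  assumes A: "nonneg_mat A" "unit_cycle_mean A" "irreducible_mat A"
    and B: "nonneg_mat B" "unit_cycle_mean B" "irreducible_mat B"
    and commute: "A \<otimes>\<^sub>m B = B \<otimes>\<^sub>m A"
  shows "\<exists>x. (\<forall>i. 0 < x i) \<and> A \<odot> x = x \<and> B \<odot> x = x"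
proof -
  obtain v where v: "\<And>i. 0 < v i" "A \<odot> v \<le> v" "B \<odot> v \<le> v"
    using ex_common_subeigenvector[OF A(1,2) B(1,2) commute] by blast
  have "(\<lambda>_. 0) \<le> v" using v(1) by (simp add: le_fun_def less_imp_le)
  from ex_eigenvector_below[OF A(1) B(1) commute this v(2)] v obtain w
    where w: "(\<lambda>_. 0) \<le> w" "A \<odot> w = w" "B \<odot> w \<le> w"
      and w_eq: "\<And>vs i. arc_prod A (zip vs (rotate1 vs)) = 1 \<Longrightarrow> i \<in> set vs \<Longrightarrow> w i = v i"
    by blast
  obtain vs where "vs \<noteq> []" "arc_prod A (zip vs (rotate1 vs)) = 1"
    using A(2) by (auto simp: unit_cycle_mean_def)
  then have "0 < w (hd vs)" using w_eq[of vs "hd vs"] v(1) by simp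
  then have w_pos: "0 < w i" for i
    using eigenvector_pos[OF A(1,3) w(1), of "hd vs" i] w(2) by simp
  from ex_eigenvector_below[OF B(1) A(1) commute[symmetric] w(1,3)] w(2) w_pos obtain x
    where x: "(\<lambda>_. 0) \<le> x" "B \<odot> x = x" "A \<odot> x = x"
      and x_eq: "\<And>vs i. arc_prod B (zip vs (rotate1 vs)) = 1 \<Longrightarrow> i \<in> set vs \<Longrightarrow> x i = w i"
    by blast
  obtain us where "us \<noteq> []" "arc_prod B (zip us (rotate1 us)) = 1"
    using B(2) by (auto simp: unit_cycle_mean_def)
  then have "0 < x (hd us)" using x_eq[of us "hd us"] w_pos by simp
  then have "0 < x i" for i
    using eigenvector_pos[OF B(1,3) x(1), of "hd us" i] x(2) by simp
  with x show ?thesis by blast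
qed

section \<open>Normalising the maximal cycle mean\<close>

lemma arc_prod_scaleR: "arc_prod (c *\<^sub>R A) es = c ^ length es * arc_prod A es"
  by (induction es) (auto simp: arc_prod_def mult_ac)

lemma finite_cycle_means:
  fixes A :: "real ^ 'n ^ ('n :: finite)"
  shows "finite {geometric_mean A (zip vs (rotate1 vs)) |vs. 1 \<le> length vs \<and> length vs \<le> CARD('n)}"
proof -
  have "finite {vs :: 'n list. length vs \<le> CARD('n)}"
    using finite_lists_length_le[of "UNIV :: 'n set"] by simp
  then show ?thesis
    by (rule finite_surj[where f = "\<lambda>vs. geometric_mean A (zip vs (rotate1 vs))"]) auto
qed

lemma geometric_mean_le_max_cycle_mean:
  fixes A :: "real ^ 'n ^ ('n :: finite)"
  assumes "vs \<noteq> []" "length vs \<le> CARD('n)"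
  shows "geometric_mean A (zip vs (rotate1 vs)) \<le> max_cycle_mean A"
  unfolding max_cycle_mean_def using assms
  by (intro Max_ge finite_cycle_means) (auto simp: Suc_le_eq)

lemma max_cycle_mean_attained:
  fixes A :: "real ^ 'n ^ ('n :: finite)"
  obtains vs where "vs \<noteq> []" "geometric_mean A (zip vs (rotate1 vs)) = max_cycle_mean A"
proof -
  let ?M = "{geometric_mean A (zip vs (rotate1 vs)) |vs. 1 \<le> length vs \<and> length vs \<le> CARD('n)}"
  have "geometric_mean A (zip [undefined] (rotate1 [undefined])) \<in> ?M"
    using zero_less_card_finite[where 'a = 'n] by (intro CollectI exI[of _ "[undefined]"]) auto
  then have "max_cycle_mean A \<in> ?M"
    unfolding max_cycle_mean_def by (intro Max_in finite_cycle_means) blast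
  then obtain vs where "max_cycle_mean A = geometric_mean A (zip vs (rotate1 vs))" "1 \<le> length vs"
    by blast
  then show thesis by (intro that[of vs]) auto
qed

lemma geometric_mean_eq: "geometric_mean A es = root (length es) (arc_prod A es)"
  by (simp add: geometric_mean_def arc_prod_def)

text \<open>
  Arcs of the digraph have positive weight, and a cycle has no repeated nodes, so its length is at most
  \<open>n\<close> and its mean is among those that are compared.
\<close>

lemma max_cycle_mean_pos:
  fixes A :: "real ^ 'n ^ ('n :: finite)"
  assumes "pre_digraph.cycle (assoc_digraph A) c"
  shows "0 < max_cycle_mean A"
proof -
  have c: "c \<noteq> []" "map snd c = rotate1 (map fst c)" "distinct (map fst c)"
    and arcs: "\<And>i j. (i, j) \<in> set c \<Longrightarrow> 0 < A $ i $ j"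
    using assms by (auto simp: cycle_iff assoc_digraph_def)
  have "length (map fst c) = card (set (map fst c))" using c(3) by (metis distinct_card)
  then have len: "length (map fst c) \<le> CARD('n)" by (metis card_mono subset_UNIV finite)
  have "\<forall>(i, j) \<in> set es. 0 < A $ i $ j \<Longrightarrow> 0 < arc_prod A es" for es
    by (induction es) (auto simp: arc_prod_def)
  then have "0 < arc_prod A c" using arcs by blast
  then have "0 < geometric_mean A c"
    using c(1) by (simp add: geometric_mean_eq)
  also have "c = zip (map fst c) (rotate1 (map fst c))"
    by (simp only: c(2)[symmetric] zip_map_fst_snd)
  also have "geometric_mean A \<dots> \<le> max_cycle_mean A"
    using c(1) len by (intro geometric_mean_le_max_cycle_mean) auto
  finally show ?thesis .
qed

lemma unit_cycle_mean_normalise: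
  fixes A :: "real ^ 'n ^ ('n :: finite)"
  assumes A: "nonneg_mat A" and pos: "0 < max_cycle_mean A"
  shows "unit_cycle_mean ((1 / max_cycle_mean A) *\<^sub>R A)"
proof -
  let ?l = "max_cycle_mean A"
  have root_pow: "root (length es) (arc_prod A es) ^ length es = arc_prod A es" if "es \<noteq> []" for es
    using that arc_prod_nonneg[OF A, of es] by simp
  have "arc_prod ((1 / ?l) *\<^sub>R A) (zip vs (rotate1 vs)) \<le> 1"
    if vs: "vs \<noteq> []" "length vs \<le> CARD('n)" for vs
  proof -
    let ?es = "zip vs (rotate1 vs)"
    have "?es \<noteq> []" using vs(1) by (cases vs) (auto simp: neq_Nil_conv zip_eq_Nil_iff)
    then have "arc_prod A ?es \<le> ?l ^ length ?es"
      using power_mono[OF geometric_mean_le_max_cycle_mean[OF vs, of A], of "length ?es"]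
        arc_prod_nonneg[OF A, of ?es] root_pow[of ?es]
      by (simp add: geometric_mean_eq real_root_ge_zero)
    then show ?thesis using pos by (simp add: arc_prod_scaleR power_divide field_simps)
  qed
  moreover obtain vs where vs: "vs \<noteq> []" "geometric_mean A (zip vs (rotate1 vs)) = ?l"
    by (rule max_cycle_mean_attained)
  let ?es = "zip vs (rotate1 vs)"
  have "?es \<noteq> []" using vs(1) by (cases vs) (auto simp: neq_Nil_conv zip_eq_Nil_iff)
  then have "arc_prod A ?es = ?l ^ length ?es"
    using root_pow[of ?es] vs(2) by (simp add: geometric_mean_eq)
  then have "arc_prod ((1 / ?l) *\<^sub>R A) ?es = 1"
    using pos by (simp add: arc_prod_scaleR power_divide field_simps)
  ultimately show ?thesis using vs(1) unfolding unit_cycle_mean_def by blast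
qed

lemma irreducible_mat_scaleR: "0 < c \<Longrightarrow> irreducible_mat (c *\<^sub>R A) \<longleftrightarrow> irreducible_mat A"
  by (simp add: irreducible_mat_def assoc_digraph_def zero_less_mult_iff)

lemma nonneg_mat_scaleR: "0 \<le> c \<Longrightarrow> nonneg_mat A \<Longrightarrow> nonneg_mat (c *\<^sub>R A)"
  by (simp add: nonneg_mat_def)

section \<open>Saturated arcs\<close>

definition saturated :: "real ^ 'n ^ ('n :: finite) \<Rightarrow> ('n \<Rightarrow> real) \<Rightarrow> 'n rel" where
  "saturated A x = {(i, j). A $ i $ j * x j = x i}"

lemma saturated_serial:
  assumes "A \<odot> x = x"
  shows "\<exists>j. (i, j) \<in> saturated A x"
proof -
  obtain j where "(A \<odot> x) i = A $ i $ j * x j" by (rule max_mult_vec_attained)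
  with assms show ?thesis by (auto simp: saturated_def)
qed

text \<open>
  A two-step product satisfies \<open>a\<^sub>i\<^sub>k b\<^sub>k\<^sub>j x\<^sub>j \<le> a\<^sub>i\<^sub>k x\<^sub>k \<le> x\<^sub>i\<close>, and the outer terms agree exactly if both steps
  are saturated.
\<close>

lemma saturated_max_mult:
  assumes A: "nonneg_mat A" and pos: "\<And>i. 0 < x i" and sub: "A \<odot> x \<le> x" "B \<odot> x \<le> x"
  shows "saturated (A \<otimes>\<^sub>m B) x = saturated A x O saturated B x"
proof (rule set_eqI, clarify)
  fix i j
  have le_A: "A $ i $ k * x k \<le> x i" and le_B: "B $ k $ j * x j \<le> x k" for k
    using sub by (auto simp: max_mult_vec_le_iff)
  have le: "A $ i $ k * B $ k $ j * x j \<le> A $ i $ k * x k" for k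
    using mult_left_mono[OF le_B[of k], of "A $ i $ k"] A by (simp add: nonneg_mat_def mult_ac)
  obtain k where k: "(A \<otimes>\<^sub>m B) $ i $ j = A $ i $ k * B $ k $ j"
    by (rule max_mult_attained)
  show "(i, j) \<in> saturated (A \<otimes>\<^sub>m B) x \<longleftrightarrow> (i, j) \<in> saturated A x O saturated B x"
  proof
    assume "(i, j) \<in> saturated (A \<otimes>\<^sub>m B) x"
    then have eq: "A $ i $ k * B $ k $ j * x j = x i" by (simp add: saturated_def k)
    with le[of k] le_A[of k] have Ak: "A $ i $ k * x k = x i" by linarith
    with pos[of i] have "A $ i $ k \<noteq> 0" by auto
    moreover have "A $ i $ k * (B $ k $ j * x j) = A $ i $ k * x k" using eq Ak by (metis mult.assoc)
    ultimately have "B $ k $ j * x j = x k" by simp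
    with Ak show "(i, j) \<in> saturated A x O saturated B x" by (auto simp: saturated_def)
  next
    assume "(i, j) \<in> saturated A x O saturated B x"
    then obtain l where l: "A $ i $ l * x l = x i" "B $ l $ j * x j = x l"
      by (auto simp: saturated_def)
    have "x i = A $ i $ l * B $ l $ j * x j" using l by (simp add: mult.assoc)
    also have "\<dots> \<le> (A \<otimes>\<^sub>m B) $ i $ j * x j"
      using pos[of j] by (intro mult_right_mono max_mult_ge) simp
    finally have "(A \<otimes>\<^sub>m B) $ i $ j * x j = x i"
      using le[of k] le_A[of k] unfolding k by linarith
    then show "(i, j) \<in> saturated (A \<otimes>\<^sub>m B) x" by (simp add: saturated_def)
  qed
qed

section \<open>Critical cycles and the theorem\<close>

text \<open>
  Dividing by the maximal cycle mean and rescaling by \<open>x\<close> gives saturated arcs the weight 1. The second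
  operation does not change the weight of a cycle, so in \<open>A\<close> itself a cycle of saturated arcs has as
  geometric mean exactly the number by which \<open>A\<close> was divided.
\<close>

lemma critical_cycle_if_saturated:
  fixes A :: "real ^ 'n ^ ('n :: finite)"
  assumes pos: "0 < max_cycle_mean A" "\<And>i. 0 < x i"
    and cyc: "pre_digraph.cycle (rel_digraph (saturated ((1 / max_cycle_mean A) *\<^sub>R A) x)) c"
  shows "critical_cycle A c"
proof -
  let ?l = "max_cycle_mean A"
  let ?A = "(1 / ?l) *\<^sub>R A"
  have c: "c \<noteq> []" "map snd c = rotate1 (map fst c)" "distinct (map fst c)"
    and sat: "\<And>i j. (i, j) \<in> set c \<Longrightarrow> ?A $ i $ j * x j = x i"
    using cyc by (auto simp: cycle_iff saturated_def)
  have "0 < A $ i $ j" if "(i, j) \<in> set c" for i j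
  proof -
    have "0 < ?A $ i $ j * x j" using sat[OF that] pos(2)[of i] by simp
    then show ?thesis using pos(1) pos(2)[of j] by (simp add: zero_less_mult_iff zero_less_divide_iff)
  qed
  then have "pre_digraph.cycle (assoc_digraph A) c"
    using c by (auto simp: cycle_iff assoc_digraph_def)
  moreover have "geometric_mean A c = ?l"
  proof -
    have zip: "zip (map fst c) (rotate1 (map fst c)) = c"
      by (simp only: c(2)[symmetric] zip_map_fst_snd)
    have "arc_prod ?A c = prod_list (map (\<lambda>(i, j). ?A $ i $ j * x j / x i) c)"
      using arc_prod_closed_rescale[of "map fst c" x ?A] pos(2) unfolding zip by (metis less_irrefl)
    also have "map (\<lambda>(i, j). ?A $ i $ j * x j / x i) c = map (\<lambda>_. 1) c"
    proof (rule map_cong[OF refl], clarify)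
      fix i j assume "(i, j) \<in> set c"
      with sat[of i j] pos(2)[of i] show "?A $ i $ j * x j / x i = 1" by simp
    qed
    finally have "arc_prod ?A c = 1" by (simp add: map_replicate_const)
    then have "arc_prod A c = ?l ^ length c"
      using pos(1) by (simp add: arc_prod_scaleR power_divide field_simps)
    then show ?thesis
      using c(1) pos(1) by (simp add: geometric_mean_eq real_root_power_cancel)
  qed
  ultimately show ?thesis by (simp add: critical_cycle_def)
qed

text \<open>
  The hypotheses are symmetric in \<open>A\<close> and \<open>B\<close>, so that both halves of the theorem are instances.
\<close>

lemma ex_critical_cycle_in_eigennodes:
  fixes A B :: "real ^ 'n ^ ('n :: finite)"
  assumes pos: "0 < max_cycle_mean A" "0 < max_cycle_mean B" "\<And>i. 0 < x i"
    and serial: "\<And>i. \<exists>j. (i, j) \<in> saturated ((1 / max_cycle_mean A) *\<^sub>R A) x"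
      "\<And>i. \<exists>j. (i, j) \<in> saturated ((1 / max_cycle_mean B) *\<^sub>R B) x"
    and commute: "saturated ((1 / max_cycle_mean A) *\<^sub>R A) x O saturated ((1 / max_cycle_mean B) *\<^sub>R B) x
      = saturated ((1 / max_cycle_mean B) *\<^sub>R B) x O saturated ((1 / max_cycle_mean A) *\<^sub>R A) x"
  shows "\<exists>c. critical_cycle A c \<and> cycle_nodes c \<subseteq> eigennodes B"
proof -
  let ?R = "saturated ((1 / max_cycle_mean A) *\<^sub>R A) x"
  let ?S = "saturated ((1 / max_cycle_mean B) *\<^sub>R B) x"
  define K where "K = {i. (i, i) \<in> ?S\<^sup>+}"
  have "\<exists>i. (i, i) \<in> (?R \<inter> K \<times> K)\<^sup>+"
    unfolding K_def by (rule commuting_relations_cycle[OF commute serial])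
  then obtain i where i: "(i, i) \<in> (?R \<inter> K \<times> K)\<^sup>+" ..
  from cycle_through_if_trancl[OF this] obtain c
    where c: "pre_digraph.cycle (rel_digraph (?R \<inter> K \<times> K)) c" by blast
  have "pre_digraph.cycle (rel_digraph ?R) c" using c by (simp add: cycle_iff)
  then have "critical_cycle A c" by (rule critical_cycle_if_saturated[OF pos(1,3)])
  moreover have "K \<subseteq> eigennodes B"
  proof
    fix k assume "k \<in> K"
    then have "(k, k) \<in> ?S\<^sup>+" by (simp only: K_def mem_Collect_eq)
    from cycle_through_if_trancl[OF this] obtain d
      where d: "pre_digraph.cycle (rel_digraph ?S) d" "k \<in> cycle_nodes d" by blast
    from critical_cycle_if_saturated[OF pos(2,3) d(1)] d(2) show "k \<in> eigennodes B"
      by (auto simp: eigennodes_def critical_digraph_def)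
  qed
  moreover have "cycle_nodes c \<subseteq> K" using c by (auto simp: cycle_iff cycle_nodes_def)
  ultimately show ?thesis by blast
qed

text \<open>
  Needed to apply the library theory of strongly connected components to the critical digraph.
\<close>

lemma wf_critical_digraph: "wf_digraph (critical_digraph A)"
proof
  fix e assume "e \<in> arcs (critical_digraph A)"
  then obtain c where c: "critical_cycle A c" "e \<in> set c" by (auto simp: critical_digraph_def)
  then have "map snd c = rotate1 (map fst c)"
    by (simp add: critical_cycle_def cycle_iff assoc_digraph_def)
  then have "snd ` set c = fst ` set c" by (metis set_map set_rotate1)
  with c have "fst e \<in> cycle_nodes c" "snd e \<in> cycle_nodes c" by (auto simp: cycle_nodes_def)
  with c(1) show "tail (critical_digraph A) e \<in> verts (critical_digraph A)"
    "head (critical_digraph A) e \<in> verts (critical_digraph A)"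
    by (auto simp: critical_digraph_def)
qed

lemma critical_cycle_imp_cycle:
  assumes "critical_cycle A c"
  shows "pre_digraph.cycle (critical_digraph A) c" "cycle_nodes c \<subseteq> eigennodes A" "cycle_nodes c \<noteq> {}"
proof -
  have c: "c \<noteq> []" "map snd c = rotate1 (map fst c)" "distinct (map fst c)"
    using assms by (auto simp: critical_cycle_def cycle_iff assoc_digraph_def)
  then have "fst (hd c) \<in> cycle_nodes c" by (simp add: cycle_nodes_def)
  with c assms show "pre_digraph.cycle (critical_digraph A) c"
    by (auto simp: cycle_iff critical_digraph_def)
  from c assms show "cycle_nodes c \<subseteq> eigennodes A" "cycle_nodes c \<noteq> {}"
    by (auto simp: eigennodes_def critical_digraph_def cycle_nodes_def)
qed

theorem theorem5p5:
  fixes A B :: "real ^ 'n ^ ('n :: finite)"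
  assumes "\<And>i j. A $ i $ j \<ge> 0" and "\<And>i j. B $ i $ j \<ge> 0"
    and "irreducible_mat A" and "irreducible_mat B"
    and "A \<otimes>\<^sub>m B = B \<otimes>\<^sub>m A"
    and "\<exists>c. pre_digraph.cycle (assoc_digraph A) c"
    and "\<exists>c. pre_digraph.cycle (assoc_digraph B) c"
  shows "(\<exists>c1. pre_digraph.cycle (critical_digraph A) c1 \<and>
            cycle_nodes c1 \<subseteq> (\<Union>H \<in> pre_digraph.sccs (critical_digraph B). verts H)) \<and>
         (\<exists>c2. pre_digraph.cycle (critical_digraph B) c2 \<and>
            cycle_nodes c2 \<subseteq> (\<Union>H \<in> pre_digraph.sccs (critical_digraph A). verts H)) \<and>
         eigennodes A \<inter> eigennodes B \<noteq> {}"
proof -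
  let ?A = "(1 / max_cycle_mean A) *\<^sub>R A" and ?B = "(1 / max_cycle_mean B) *\<^sub>R B"
  have pos: "0 < max_cycle_mean A" "0 < max_cycle_mean B"
    using assms(6,7) max_cycle_mean_pos by blast+
  have nonneg: "nonneg_mat A" "nonneg_mat B" using assms(1,2) by (auto simp: nonneg_mat_def)
  then have nonneg': "nonneg_mat ?A" "nonneg_mat ?B" using pos by (simp_all add: nonneg_mat_scaleR)
  have commute: "?A \<otimes>\<^sub>m ?B = ?B \<otimes>\<^sub>m ?A"
    using pos assms(5) by (simp add: max_mult_scaleR mult.commute)
  have unit: "unit_cycle_mean ?A" "unit_cycle_mean ?B"
    using nonneg pos by (auto intro!: unit_cycle_mean_normalise)
  have irreducible: "irreducible_mat ?A" "irreducible_mat ?B"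
    using assms(3,4) pos by (simp_all add: irreducible_mat_scaleR)
  obtain x where x: "\<And>i. 0 < x i" "?A \<odot> x = x" "?B \<odot> x = x"
    using ex_common_eigenvector[OF nonneg'(1) unit(1) irreducible(1)
        nonneg'(2) unit(2) irreducible(2) commute] by blast
  have sub: "?A \<odot> x \<le> x" "?B \<odot> x \<le> x" unfolding x by (rule order_refl)+
  have sat: "saturated ?A x O saturated ?B x = saturated ?B x O saturated ?A x"
    unfolding saturated_max_mult[OF nonneg'(1) x(1) sub, symmetric]
      saturated_max_mult[OF nonneg'(2) x(1) sub(2,1), symmetric] commute by (rule refl)
  note serial = saturated_serial[OF x(2)] saturated_serial[OF x(3)]
  obtain c1 where c1: "critical_cycle A c1" "cycle_nodes c1 \<subseteq> eigennodes B"
    using ex_critical_cycle_in_eigennodes[OF pos x(1) serial sat] by blast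
  obtain c2 where c2: "critical_cycle B c2" "cycle_nodes c2 \<subseteq> eigennodes A"
    using ex_critical_cycle_in_eigennodes[OF pos(2,1) x(1) serial(2,1) sat[symmetric]] by blast
  show ?thesis
    unfolding Union_verts_sccs[OF wf_critical_digraph] eigennodes_def[symmetric]
    using critical_cycle_imp_cycle[OF c1(1)] critical_cycle_imp_cycle(1)[OF c2(1)] c1(2) c2(2)
    by blast
qed

end
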